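(* Let $\rho$ be an alignment-free $2$-uniform sock ordering of length $2n$, and let $\sigma_\rho=\sigma_\rho(1)\cdots\sigma_\rho(n)$ be the corresponding permutation in $S_n$. Then $\rho$ is foot-sortable if and only if one of the following holds: (i) $\sigma_\rho(1)<n$, and the permutation $\sigma_\rho(2)\sigma_\rho(3)\cdots\sigma_\rho(n)$ avoids the patterns $123$, $132$, and $213$; (ii) $\sigma_\rho(1)=n$, and the permutation $\sigma_\rho(3)\sigma_\rho(4)\cdots\sigma_\rho(n)$ avoids the patterns $123$, $132$, and $213$. Moreover, there are exactly $(n-1)F_{n+1}$ foot-sortable alignment-free $2$-uniform sock orderings of length $2n$.
   Context: A sock ordering of length $N$ is a finite line (sequence) of $N$ socks, each having a color, where two sequences are considered the same sock ordering if one is obtained from the other by (injectively) renaming colors. Equivalently, a sock ordering of length $N$ is a set partition of $[N]=\{1,\ldots,N\}$, where $i$ and $j$ lie in the same block if and only if the socks in positions $i$ and $j$ have the same color. A sock ordering is sorted if all socks of each color appear consecutively. Foot-sorting algorithm (non-deterministic, one foot): initially the whole sock ordering is a line to the right of the foot, the foot is empty, and there are no socks to the left of the foot. At each point in time one performs one of the following operations: (1) take the leftmost sock that lies to the right of the foot and put it onto the foot, over all socks already on the foot; (2) remove the outermost (most recently put on) sock from the foot and place it to the left of the foot, to the right of all other socks that are to the left of the foot. The process ends when all socks are to the left of the foot; the line of socks on the left is the resulting sock ordering. (Thus the foot is a stack.) A sock ordering is foot-sortable if some choice of operations transforms it into a sorted sock ordering. A sock ordering is $2$-uniform if there are exactly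 $2$ socks of each color. A $2$-uniform sock ordering with $2n$ socks is alignment-free if its first $n$ socks all have distinct colors. Such a sock ordering $\rho$ is represented by a unique word of the form $1\,2\cdots n\,\sigma_\rho(1)\,\sigma_\rho(2)\cdots\sigma_\rho(n)$ (i.e., socks in two positions have the same color if and only if the letters in these positions are equal), where $\sigma_\rho=\sigma_\rho(1)\cdots\sigma_\rho(n)$ is a permutation in $S_n$, the set of permutations of $\{1,\ldots,n\}$ in one-line notation; this $\sigma_\rho$ is the permutation corresponding to $\rho$. A permutation here is any finite sequence of distinct positive integers. It avoids a pattern $v\in S_3$ if it has no (not necessarily consecutive) length-$3$ subsequence whose entries are in the same relative order as $v$; in particular, sequences of length less than $3$ (including the empty sequence) avoid all three patterns. $(F_k)_{k\ge1}$ is the Fibonacci sequence: $F_1=F_2=1$ and $F_k=F_{k-1}+F_{k-2}$ for all $k\geq 3$.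
   Formalization: The characterization is stated for n ≥ 1; the count (n-1)F_{n+1} is stated only for n ≥ 2, because for n = 1 the single ordering "1 1" is foot-sortable, so the count is 1 while the formula gives 0. *)

theory Defs
  imports
    "HOL-Library.Disjoint_Sets"
    "HOL-Library.Sublist"
    "HOL-Combinatorics.Multiset_Permutations"
    "HOL-Number_Theory.Fib"
begin

section \<open>Sock orderings\<close>

text \<open>A sock ordering of length \<open>N\<close> is a set partition of \<open>{1..N}\<close>; its blocks are the
  sets of positions carrying socks of one color.\<close>

definition sock_ordering :: "nat \<Rightarrow> nat set set \<Rightarrow> bool" where
  "sock_ordering N \<rho> \<longleftrightarrow> partition_on {1..N} \<rho>"

text \<open>The sock ordering of a line of socks, given by its colors from left to right.
  Positions are counted from 1. Two lines have the same image iff one arises from the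
  other by an injective renaming of colors.\<close>

definition sock_ordering_of :: "'c list \<Rightarrow> nat set set" where
  "sock_ordering_of w = {{i \<in> {1..length w}. w ! (i - 1) = c} | c. c \<in> set w}"

definition two_uniform :: "nat set set \<Rightarrow> bool" where
  "two_uniform \<rho> \<longleftrightarrow> (\<forall>B\<in>\<rho>. card B = 2)"

definition alignment_free :: "nat \<Rightarrow> nat set set \<Rightarrow> bool" where
  "alignment_free n \<rho> \<longleftrightarrow>
     (\<forall>B\<in>\<rho>. \<forall>i\<in>B. \<forall>j\<in>B. i \<le> n \<longrightarrow> j \<le> n \<longrightarrow> i = j)"

definition alignment_free_2_uniform :: "nat \<Rightarrow> nat set set \<Rightarrow> bool" where
  "alignment_free_2_uniform n \<rho> \<longleftrightarrow>
     sock_ordering (2 * n) \<rho> \<and> two_uniform \<rho> \<and> alignment_free n \<rho>"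

text \<open>The permutation of \<open>{1..n}\<close>, in one-line notation, such that the word
  \<open>1 2 \<dots> n \<sigma>(1) \<dots> \<sigma>(n)\<close> represents \<open>\<rho>\<close>. It exists and is unique when
  \<open>alignment_free_2_uniform n \<rho>\<close> holds.\<close>

definition sock_perm :: "nat \<Rightarrow> nat set set \<Rightarrow> nat list" where
  "sock_perm n \<rho> =
     (THE \<sigma>. \<sigma> \<in> permutations_of_set {1..n} \<and> sock_ordering_of ([1..<Suc n] @ \<sigma>) = \<rho>)"

section \<open>Foot-sorting\<close>

text \<open>A state consists of the socks to the left of the foot (from left to right), the socks
  on the foot (outermost first), and the socks to the right of the foot (from left to
  right).\<close>

inductive foot_step ::
  "'c list \<times> 'c list \<times> 'c list \<Rightarrow> 'c list \<times> 'c list \<times> 'c list \<Rightarrow> bool" where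
  put_on: "foot_step (L, F, x # R) (L, x # F, R)"
| take_off: "foot_step (L, x # F, R) (L @ [x], F, R)"

definition sorted_socks :: "'c list \<Rightarrow> bool" where
  "sorted_socks w \<longleftrightarrow>
     (\<forall>i j k. i < j \<longrightarrow> j < k \<longrightarrow> k < length w \<longrightarrow> w ! i = w ! k \<longrightarrow> w ! j = w ! i)"

text \<open>The line \<open>w\<close> may be any line representing \<open>\<rho>\<close>: the process never looks at colors, and
  sortedness is invariant under injective renaming, so the choice does not matter.\<close>

definition foot_sortable :: "nat set set \<Rightarrow> bool" where
  "foot_sortable \<rho> \<longleftrightarrow>
     (\<exists>(w :: nat list) w'. sock_ordering_of w = \<rho> \<and>
        foot_step\<^sup>*\<^sup>* ([], [], w) (w', [], []) \<and> sorted_socks w')"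

section \<open>Pattern avoidance\<close>

definition contains_pattern :: "nat list \<Rightarrow> nat list \<Rightarrow> bool" where
  "contains_pattern p v \<longleftrightarrow>
     (\<exists>t. subseq t p \<and> length t = length v \<and>
        (\<forall>i < length v. \<forall>j < length v. t ! i < t ! j \<longleftrightarrow> v ! i < v ! j))"

definition avoids_all :: "nat list \<Rightarrow> nat list set \<Rightarrow> bool" where
  "avoids_all p V \<longleftrightarrow> (\<forall>v\<in>V. \<not> contains_pattern p v)"

end

theory Submission
  imports Defs
begin

text \<open>In a sorted final line, the two socks of each color come off consecutively. This blocks a run in
  two ways: a sock must not be put on the foot above its buried partner
  (\<open>not_can_finish_nested\<close>), and while a color waits on the left for its second sock, no other
  color may be taken off (\<open>not_can_finish_separated\<close>).

  Suppose first that the foot carries one sock of every remaining color. If the outermost color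
  \<open>m\<close> does not arrive next, \<open>m\<close> has to be set aside; then the arriving sock must match the sock
  now outermost, and \<open>m\<close> must arrive right afterwards (\<open>waiting_forced\<close>). So the sequence of
  arriving socks is the sequence on the foot with some disjoint pairs of neighbours exchanged.
  The foot is loaded with \<open>1, \<dots>, n\<close>, so it is decreasing from the outside in, and for a decreasing
  sequence these rearrangements are exactly the permutations avoiding 123, 132 and 213; there
  are \<open>fib (k + 1)\<close> of them on \<open>k\<close> entries.

  During the first half at most one color can be set aside (\<open>at_most_one_taken_off\<close>). It is best
  spent on \<open>\<sigma>(1)\<close>, so that only the rest of \<open>\<sigma>\<close> has to meet the condition above. But if
  \<open>\<sigma>(1) = n\<close>, then \<open>\<sigma>(1)\<close> meets its partner outermost on the foot, and the color set aside
  can be \<open>\<sigma>(2)\<close> instead. Necessity follows from the same analysis, because deleting colors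
  keeps a line foot-sortable (\<open>can_finish_filter\<close>). The count distinguishes the two cases:
  \<open>(n - 1) * fib n + (n - 1) * fib (n - 1) = (n - 1) * fib (n + 1)\<close>.\<close>

section \<open>Sorted lines\<close>

text \<open>A line is unsorted exactly if it has a subsequence \<open>x y x\<close> with \<open>y \<noteq> x\<close>. In this form
  sortedness visibly passes to subsequences, and every obstruction below is such a subsequence
  of the final line.\<close>

lemma sorted_socks_iff_subseq:
  "sorted_socks w \<longleftrightarrow> (\<forall>x y. subseq [x, y, x] w \<longrightarrow> x = y)"
proof (intro iffI allI impI)
  fix x y assume s: "sorted_socks w" and sub: "subseq [x, y, x] w"
  obtain a v where 1: "w = a @ x # v" "subseq [y, x] v"
    using list_emb_ConsD[OF sub] by auto
  obtain b v' where 2: "v = b @ y # v'" "subseq [x] v'"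
    using list_emb_ConsD[OF 1(2)] by auto
  obtain c d where 3: "v' = c @ x # d"
    using list_emb_ConsD[OF 2(2)] by auto
  let ?i = "length a" and ?j = "Suc (length a + length b)"
    and ?k = "Suc (Suc (length a + length b + length c))"
  have w: "w = a @ x # b @ y # c @ x # d" using 1 2 3 by simp
  have "w ! ?i = x" "w ! ?j = y" "w ! ?k = x" "?i < ?j" "?j < ?k" "?k < length w"
    unfolding w by (simp_all add: nth_append nth_Cons')
  then show "x = y" using s unfolding sorted_socks_def by metis
next
  assume r: "\<forall>x y. subseq [x, y, x] w \<longrightarrow> x = y"
  show "sorted_socks w" unfolding sorted_socks_def
  proof (intro allI impI)
    fix i j k assume ijk: "i < j" "j < k" "k < length w" and eq: "w ! i = w ! k"
    have "w = take i w @ w ! i # drop (Suc i) w"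
      using ijk by (intro id_take_nth_drop) simp
    moreover have "drop (Suc i) w =
        take (j - Suc i) (drop (Suc i) w) @ w ! j # drop (Suc j) w"
      using id_take_nth_drop[of "j - Suc i" "drop (Suc i) w"] ijk by simp
    moreover have "w ! k \<in> set (drop (Suc j) w)"
      using ijk by (auto simp: in_set_conv_nth intro!: exI[of _ "k - Suc j"])
    ultimately have "subseq [w ! i, w ! j, w ! k] w"
      by (metis list_emb_append2 subseq_Cons2 subseq_singleton_left)
    then show "w ! j = w ! i" using r eq by metis
  qed
qed

lemma sorted_socks_subseq: "sorted_socks w \<Longrightarrow> subseq v w \<Longrightarrow> sorted_socks v"
  unfolding sorted_socks_iff_subseq using subseq_order.order_trans by blast

lemma sorted_socks_append:
  assumes "sorted_socks u" "sorted_socks v" "set u \<inter> set v = {}"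
  shows "sorted_socks (u @ v)"
  unfolding sorted_socks_def
proof (intro allI impI)
  fix i j k
  assume *: "i < j" "j < k" "k < length (u @ v)" "(u @ v) ! i = (u @ v) ! k"
  consider "k < length u" | "length u \<le> i" | "i < length u" "length u \<le> k" by linarith
  then show "(u @ v) ! j = (u @ v) ! i"
  proof cases
    case 1
    then show ?thesis using * assms(1) by (auto simp: sorted_socks_def nth_append)
  next
    case 2
    have "i - length u < j - length u" "j - length u < k - length u" "k - length u < length v"
      using 2 * by auto
    then show ?thesis using 2 * assms(2) by (auto simp: sorted_socks_def nth_append)
  next
    case 3
    then have "u ! i \<in> set u" "v ! (k - length u) \<in> set v" using * by auto
    moreover have "u ! i = v ! (k - length u)" using 3 * by (simp add: nth_append)
    ultimately show ?thesis using assms(3) by auto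
  qed
qed

lemma sorted_socks_map:
  assumes "inj_on f (set w)" "sorted_socks w"
  shows "sorted_socks (map f w)"
  using assms unfolding sorted_socks_def by (auto simp: inj_on_eq_iff)

section \<open>Runs of the foot that end sorted\<close>

text \<open>The line \<open>L\<close> to the left of the foot is a parameter so that one can follow a run step by step;
  the socks already there constrain the rest of the run only through sortedness.\<close>

definition can_finish :: "'c list \<Rightarrow> 'c list \<Rightarrow> 'c list \<Rightarrow> bool" where
  "can_finish L F R \<longleftrightarrow> (\<exists>w. foot_step\<^sup>*\<^sup>* (L, F, R) (w, [], []) \<and> sorted_socks w)"

lemma can_finish_cases:
  assumes "can_finish L F R"
  obtains (finished) "F = []" "R = []"
  | (put_on) x R' where "R = x # R'" "can_finish L (x # F) R'"
  | (take_off) x F' where "F = x # F'" "can_finish (L @ [x]) F' R"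
proof -
  from assms obtain w where st: "foot_step\<^sup>*\<^sup>* (L, F, R) (w, [], [])" and w: "sorted_socks w"
    by (auto simp: can_finish_def)
  from st show thesis
  proof (cases rule: converse_rtranclpE)
    case base
    then show ?thesis using finished by simp
  next
    case (step s)
    from step(1) show ?thesis
      by cases (use step(2) w put_on take_off in \<open>auto simp: can_finish_def\<close>)
  qed
qed

lemma can_finish_put_on: "can_finish L (x # F) R \<Longrightarrow> can_finish L F (x # R)"
  unfolding can_finish_def by (meson converse_rtranclp_into_rtranclp foot_step.put_on)

lemma can_finish_take_off: "can_finish (L @ [x]) F R \<Longrightarrow> can_finish L (x # F) R"
  unfolding can_finish_def by (meson converse_rtranclp_into_rtranclp foot_step.take_off)

lemma can_finish_put_on_all: "can_finish L (rev A @ F) R \<Longrightarrow> can_finish L F (A @ R)"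
proof (induction A arbitrary: F)
  case (Cons a A)
  then show ?case using can_finish_put_on[of L a F "A @ R"] by simp
qed simp

text \<open>The socks on the foot leave it in their order from the outside in, interleaved with the socks
  still to come. So a conflict between socks on the foot persists in the final line.\<close>

lemma foot_steps_result:
  assumes "foot_step\<^sup>*\<^sup>* (L, F, R) (w, [], [])"
  shows "\<exists>u. w = L @ u \<and> subseq F u \<and> set u = set F \<union> set R"
  using assms
proof (induction "(L, F, R)" arbitrary: L F R rule: converse_rtranclp_induct)
  case base
  then show ?case by simp
next
  case (step s)
  from step(1) show ?case
  proof cases
    case (put_on x R')
    then show ?thesis using step(3)[of L "x # F" R'] by (auto dest: subseq_Cons')
  next
    case (take_off x F')
    then show ?thesis using step(3)[of "L @ [x]" F' R] by auto
  qed
qed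

text \<open>This is how a run gets stuck on the foot: \<open>x\<close> is put on \<open>y\<close> while another \<open>x\<close> is buried
  below.\<close>

lemma not_can_finish_nested:
  assumes "x \<noteq> y" "x \<in> set F"
  shows "\<not> can_finish L (x # y # F) R"
proof
  assume "can_finish L (x # y # F) R"
  then obtain w where w: "foot_step\<^sup>*\<^sup>* (L, x # y # F, R) (w, [], [])" "sorted_socks w"
    by (auto simp: can_finish_def)
  from foot_steps_result[OF w(1)] obtain u where u: "w = L @ u" "subseq (x # y # F) u" by blast
  have "subseq [x, y, x] (x # y # F)" using assms(2) by (simp add: subseq_singleton_left)
  then have "subseq [x, y, x] w" unfolding u(1)
    using u(2) subseq_order.order_trans by (blast intro: list_emb_append2)
  then show False using w(2) assms(1) by (auto simp: sorted_socks_iff_subseq)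
qed

text \<open>Once \<open>x\<close> is taken off while another \<open>x\<close> remains, no other color may come off before it.\<close>

lemma not_can_finish_separated:
  assumes "x \<noteq> y" "x \<in> set F \<union> set R"
  shows "\<not> can_finish [x, y] F R"
proof
  assume "can_finish [x, y] F R"
  then obtain w where w: "foot_step\<^sup>*\<^sup>* ([x, y], F, R) (w, [], [])" "sorted_socks w"
    by (auto simp: can_finish_def)
  from foot_steps_result[OF w(1)] obtain u where u: "w = [x, y] @ u" "x \<in> set u"
    using assms(2) by blast
  then have "subseq [x, y, x] w" by (simp add: subseq_singleton_left)
  then show False using w(2) assms(1) by (auto simp: sorted_socks_iff_subseq)
qed

lemma foot_steps_prepend:
  assumes "foot_step\<^sup>*\<^sup>* (L, F, R) (w, F', R')"
  shows "foot_step\<^sup>*\<^sup>* (K @ L, F, R) (K @ w, F', R')"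
  using assms
proof (induction "(L, F, R)" arbitrary: L F R rule: converse_rtranclp_induct)
  case base
  then show ?case by simp
next
  case (step s)
  from step(1) show ?case
  proof cases
    case (put_on x R1)
    then show ?thesis using step(3)[of L "x # F" R1]
      by (auto intro: converse_rtranclp_into_rtranclp foot_step.put_on)
  next
    case (take_off x F1)
    then have "foot_step\<^sup>*\<^sup>* ((K @ L) @ [x], F1, R) (K @ w, F', R')"
      using step(3)[of "L @ [x]" F1 R] by simp
    then show ?thesis unfolding take_off
      by (rule converse_rtranclp_into_rtranclp[where r = foot_step, OF foot_step.take_off])
  qed
qed

text \<open>Colors that are completely processed can be forgotten.\<close>

lemma can_finish_prepend:
  assumes "can_finish [] F R" "sorted_socks L" "set L \<inter> (set F \<union> set R) = {}"
  shows "can_finish L F R"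
proof -
  from assms(1) obtain w where w: "foot_step\<^sup>*\<^sup>* ([], F, R) (w, [], [])" "sorted_socks w"
    by (auto simp: can_finish_def)
  have "set w = set F \<union> set R" using foot_steps_result[OF w(1)] by auto
  then have "sorted_socks (L @ w)" using assms w(2) by (intro sorted_socks_append) auto
  then show ?thesis using foot_steps_prepend[OF w(1), of L] by (auto simp: can_finish_def)
qed

text \<open>Removing all socks of some colors keeps a line foot-sortable: the same run, with the moves of
  the removed socks left out, ends in a subsequence of a sorted line. In the necessity proofs
  this isolates the part of a line that is still to be understood, without following the run
  through the rest.\<close>

lemma can_finish_filter:
  assumes "can_finish L F R"
  shows "can_finish (filter P L) (filter P F) (filter P R)"
proof -
  from assms obtain w where st: "foot_step\<^sup>*\<^sup>* (L, F, R) (w, [], [])" and w: "sorted_socks w"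
    by (auto simp: can_finish_def)
  have "sorted_socks (filter P w)" using w by (rule sorted_socks_subseq) simp
  with st show ?thesis
  proof (induction "(L, F, R)" arbitrary: L F R rule: converse_rtranclp_induct)
    case base
    then show ?case by (auto simp: can_finish_def)
  next
    case (step s)
    from step(1) show ?case
    proof cases
      case (put_on x R1)
      then show ?thesis using step(3)[of L "x # F" R1] step(4)
        by (auto intro: can_finish_put_on split: if_splits)
    next
      case (take_off x F1)
      then show ?thesis using step(3)[of "L @ [x]" F1 R] step(4)
        by (auto intro: can_finish_take_off split: if_splits)
    qed
  qed
qed

lemma can_finish_map:
  assumes "can_finish [] [] w" "inj_on f (set w)"
  shows "can_finish [] [] (map f w)"
proof -
  have *: "foot_step\<^sup>*\<^sup>* (map f L, map f F, map f R) (map f u, [], [])"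
    if "foot_step\<^sup>*\<^sup>* (L, F, R) (u, [], [])" for L F R u
    using that
  proof (induction "(L, F, R)" arbitrary: L F R rule: converse_rtranclp_induct)
    case base
    then show ?case by simp
  next
    case (step s)
    from step(1) show ?case
    proof cases
      case (put_on x R1)
      then show ?thesis using step(3)[of L "x # F" R1]
        by (auto intro: converse_rtranclp_into_rtranclp foot_step.put_on)
    next
      case (take_off x F1)
      then show ?thesis using step(3)[of "L @ [x]" F1 R]
        by (auto intro: converse_rtranclp_into_rtranclp foot_step.take_off)
    qed
  qed
  from assms(1) obtain u where u: "foot_step\<^sup>*\<^sup>* ([], [], w) (u, [], [])" "sorted_socks u"
    by (auto simp: can_finish_def)
  have "set u = set w" using foot_steps_result[OF u(1)] by auto
  then show ?thesis using *[OF u(1)] sorted_socks_map[of f u] u(2) assms(2)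
    by (auto simp: can_finish_def)
qed

section \<open>A loaded foot\<close>

text \<open>\<open>R\<close> arises from \<open>F\<close> by exchanging disjoint pairs of neighbours. For decreasing \<open>F\<close> these are
  the reverses of layered permutations with layers of size at most 2.\<close>

inductive adjacent_swaps :: "'c list \<Rightarrow> 'c list \<Rightarrow> bool" where
  Nil: "adjacent_swaps [] []"
| keep: "adjacent_swaps F R \<Longrightarrow> adjacent_swaps (x # F) (x # R)"
| swap: "adjacent_swaps F R \<Longrightarrow> adjacent_swaps (x # y # F) (y # x # R)"

lemma adjacent_swaps_set: "adjacent_swaps F R \<Longrightarrow> set R = set F"
  by (induction rule: adjacent_swaps.induct) auto

lemma adjacent_swaps_mset: "adjacent_swaps F R \<Longrightarrow> mset R = mset F"
  by (induction rule: adjacent_swaps.induct) auto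

lemma waiting_put_on:
  assumes "can_finish [x] F (r # R)" "x \<notin> set F" "x \<in> set (r # R)"
  shows "can_finish [x] (r # F) R"
  using assms(1)
proof (cases rule: can_finish_cases)
  case (take_off y F')
  then show ?thesis using assms(2,3) not_can_finish_separated[of x y F' "r # R"] by auto
qed auto

text \<open>While the first \<open>x\<close> waits on the left for its partner, nothing can be taken off, so the next
  sock \<open>r\<close> must go onto the foot, and onto its own partner. Any other color arriving next
  would have to be put on the pair of \<open>r\<close>, which buries its partner; so \<open>x\<close> arrives next.\<close>

lemma waiting_forced:
  assumes "can_finish [x] F (r # R)" "x \<notin> set F" "x \<in> set R" "distinct (r # R)"
    and "set (r # R) - {x} \<subseteq> set F"
  obtains G R' where "F = r # G" "R = x # R'"
proof -
  have "r \<noteq> x" using assms by auto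
  then have "r \<in> set F" using assms(5) by auto
  then obtain f G where F: "F = f # G" by (cases F) auto
  have 1: "can_finish [x] (r # F) R" using assms by (intro waiting_put_on) auto
  have "r = f"
    using not_can_finish_nested[of r f G "[x]" R] 1 \<open>r \<in> set F\<close> unfolding F by auto
  obtain s R' where R: "R = s # R'" using assms(3) by (cases R) auto
  have "s = x"
  proof (rule ccontr)
    assume "s \<noteq> x"
    have 2: "can_finish [x] (s # r # F) R'"
      using 1 assms \<open>r \<noteq> x\<close> unfolding R by (intro waiting_put_on) auto
    have "s \<noteq> r" "s \<in> set F" using assms \<open>s \<noteq> x\<close> unfolding R by auto
    then show False using 2 not_can_finish_nested[of s r F "[x]" R'] by auto
  qed
  then show thesis using that F R \<open>r = f\<close> by blast
qed

text \<open>If the foot carries every color once, with \<open>m\<close> outermost, then either \<open>m\<close> arrives first, or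
  \<open>m\<close> must be taken off to wait, and then exactly the next sock \<open>y\<close> on the foot arrives, followed
  by \<open>m\<close>. These are the two rules of \<^const>\<open>adjacent_swaps\<close>.\<close>

lemma can_finish_imp_adjacent_swaps:
  assumes "can_finish [] F R" "distinct F" "distinct R" "set R = set F"
  shows "adjacent_swaps F R"
  using assms
proof (induction "length F" arbitrary: F R rule: less_induct)
  case less
  show ?case
  proof (cases F)
    case Nil
    then show ?thesis using less.prems by (auto intro: adjacent_swaps.Nil)
  next
    case F: (Cons m F')
    then obtain r R' where R: "R = r # R'" using less.prems by (cases R) auto
    have del: "can_finish [] (filter P F) (filter P R)" for P
      using can_finish_filter[OF less.prems(1), of P] by simp
    show ?thesis
    proof (cases "r = m")
      case True
      have *: "filter (\<lambda>c. c \<noteq> m) F = F'" "filter (\<lambda>c. c \<noteq> m) R = R'"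
        using less.prems True unfolding F R by (auto simp: filter_id_conv)
      then have "set R' = set F'" using less.prems(4) by (metis set_filter)
      then have "adjacent_swaps F' R'"
        using del[of "\<lambda>c. c \<noteq> m"] * less.prems True unfolding R
        by (intro less.hyps) (simp_all add: F)
      then show ?thesis unfolding F R True by (rule adjacent_swaps.keep)
    next
      case False
      have mem: "r \<in> set F'" "m \<in> set R'" using False less.prems unfolding F R by auto
      have "\<not> can_finish [] (r # F) R'"
        using not_can_finish_nested[of r m F'] False mem unfolding F by auto
      then have "can_finish [m] F' (r # R')"
        using less.prems(1) unfolding F R by (auto elim: can_finish_cases)
      moreover have "set R - {m} \<subseteq> set F'" "m \<notin> set F'" "distinct (r # R')"
        using less.prems unfolding F R by auto
      ultimately obtain G R'' where G: "F' = r # G" "R' = m # R''"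
        using mem(2) waiting_forced[of m F' r R'] unfolding R by blast
      have *: "filter (\<lambda>c. c \<noteq> m \<and> c \<noteq> r) F = G" "filter (\<lambda>c. c \<noteq> m \<and> c \<noteq> r) R = R''"
        using less.prems unfolding F R G by (auto simp: filter_id_conv)
      then have "set R'' = set G" using less.prems(4) by (metis set_filter)
      then have "adjacent_swaps G R''"
        using del[of "\<lambda>c. c \<noteq> m \<and> c \<noteq> r"] * less.prems unfolding R G
        by (intro less.hyps) (simp_all add: F G)
      then show ?thesis unfolding F R G by (rule adjacent_swaps.swap)
    qed
  qed
qed

lemma adjacent_swaps_imp_can_finish:
  assumes "adjacent_swaps F R" "distinct F"
  shows "can_finish [] F R"
  using assms
proof (induction rule: adjacent_swaps.induct)
  case Nil
  then show ?case by (auto simp: can_finish_def sorted_socks_def)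
next
  case (keep F R x)
  have "sorted_socks [x, x]" by (auto simp: sorted_socks_def less_Suc_eq)
  then have "can_finish [x, x] F R"
    using keep adjacent_swaps_set[OF keep(1)] by - (rule can_finish_prepend, auto)
  then have "can_finish [] (x # x # F) R"
    using can_finish_take_off[of "[]" x] can_finish_take_off[of "[x]" x] by simp
  then show ?case by (rule can_finish_put_on)
next
  case (swap F R x y)
  have "sorted_socks ([x, x] @ [y, y])"
    using swap by (intro sorted_socks_append) (auto simp: sorted_socks_def less_Suc_eq)
  then have "can_finish [x, x, y, y] F R"
    using swap adjacent_swaps_set[OF swap(1)] by - (rule can_finish_prepend, auto)
  then have "can_finish [x] (x # y # y # F) R"
    using can_finish_take_off[of "[x]" x] can_finish_take_off[of "[x, x]" y]
      can_finish_take_off[of "[x, x, y]" y] by simp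
  then have "can_finish [x] (y # F) (y # x # R)"
    by (intro can_finish_put_on)
  then show ?case
    using can_finish_take_off[of "[]" x] by simp
qed


section \<open>Lines that start with one sock of each color\<close>

lemma waiting_put_on_line:
  assumes "can_finish [x] F (A @ R)" "x \<notin> set (A @ F)" "x \<in> set R"
  shows "can_finish [x] (rev A @ F) R"
  using assms
proof (induction A arbitrary: F)
  case (Cons a A)
  then have "can_finish [x] (a # F) (A @ R)" by (intro waiting_put_on) auto
  then show ?case using Cons by simp
qed simp

text \<open>While the first socks of the colors \<open>A\<close> are put on, at most one of them can be taken off: it
  waits for its partner, which comes only after all of \<open>A\<close>, and blocks the others meanwhile.\<close>

lemma at_most_one_taken_off:
  assumes "can_finish [] F (A @ R)" "distinct (A @ F)" "set (A @ F) \<subseteq> set R"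
  shows "can_finish [] (rev A @ F) R \<or>
    (\<exists>x \<in> set (A @ F). can_finish [x] (removeAll x (rev A @ F)) R)"
  using assms
proof (induction A arbitrary: F)
  case (Cons a A)
  from Cons.prems(1) show ?case
  proof (cases rule: can_finish_cases)
    case (put_on x R')
    then show ?thesis using Cons.IH[of "a # F"] Cons.prems by auto
  next
    case (take_off x F')
    have "can_finish [x] (rev (a # A) @ F') R"
      using take_off Cons.prems by (intro waiting_put_on_line) auto
    moreover have "removeAll x (rev (a # A) @ F) = rev (a # A) @ F'"
      using Cons.prems take_off by auto
    ultimately show ?thesis using take_off by (metis Un_iff list.set_intros(1) set_append)
  qed simp
qed simp

text \<open>The foot may carry colors whose second sock has already been dealt with; they are dropped from
  \<open>F\<close> before the comparison.\<close>

definition subline_swaps :: "'c list \<Rightarrow> 'c list \<Rightarrow> bool" where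
  "subline_swaps F R \<longleftrightarrow> adjacent_swaps (filter (\<lambda>c. c \<in> set R) F) R"

text \<open>Deleting all colors outside \<open>S\<close> leaves a loaded foot, whatever the state of the deleted colors.\<close>

lemma can_finish_imp_subline_swaps:
  assumes "can_finish L F R" "set L \<inter> set S = {}" "distinct F" "distinct R"
    and "filter (\<lambda>c. c \<in> set S) R = S"
    and "filter (\<lambda>c. c \<in> set S) F = filter (\<lambda>c. c \<in> set S) G" "set S \<subseteq> set G"
  shows "subline_swaps G S"
proof -
  let ?D = "filter (\<lambda>c. c \<in> set S)"
  have "can_finish (?D L) (?D F) (?D R)" using assms(1) by (rule can_finish_filter)
  moreover have "?D L = []" using assms(2) by (auto simp: filter_empty_conv)
  ultimately have "can_finish [] (?D F) S" using assms(5) by simp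
  moreover have "distinct S" using assms(4,5) by (metis distinct_filter)
  moreover have "set S = set (?D F)" using assms(6,7) by auto
  ultimately have "adjacent_swaps (?D F) S"
    using assms(3) by (intro can_finish_imp_adjacent_swaps) auto
  then show ?thesis using assms(6) by (simp add: subline_swaps_def)
qed

text \<open>Let \<open>x\<close> be the sock taken off during the first half, if there is one. Forgetting colors yields
  the claim at once unless \<open>x\<close> waits while \<open>s \<noteq> x\<close> arrives. Then \<open>s\<close> must lie outermost and \<open>x\<close>
  must come next. If \<open>s\<close> is the last color of \<open>A\<close>, both \<open>s\<close> and \<open>x\<close> can be forgotten; if not, \<open>s\<close>
  is outermost only because \<open>x\<close> is the last color of \<open>A\<close>, so forgetting \<open>s\<close> alone leaves a foot
  with \<open>x\<close> outermost and \<open>x\<close> arriving next.\<close>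

lemma can_finish_repeated_line_imp_swaps:
  assumes A: "distinct A" and \<sigma>: "distinct (s # \<tau>)" "set (s # \<tau>) = set A"
    and fin: "can_finish [] [] (A @ s # \<tau>)"
  shows "subline_swaps (rev A) (if s = last A then tl \<tau> else \<tau>)"
proof -
  let ?F = "rev A" and ?D = "\<lambda>S. filter (\<lambda>c. c \<in> set S)"
  have sub: "set (tl \<tau>) \<subseteq> set \<tau>" "distinct (tl \<tau>)" using \<sigma> by (cases \<tau>; auto)+
  have D\<tau>: "?D \<tau> (s # \<tau>) = \<tau>" "?D (tl \<tau>) (s # \<tau>) = tl \<tau>"
    "?D (tl \<tau>) \<tau> = tl \<tau>"
    using \<sigma> sub by (cases \<tau>; auto simp: filter_id_conv)+
  have gen: "subline_swaps ?F S" if "can_finish L F (s # \<tau>)" "set L \<inter> set S = {}"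
    "distinct F" "?D S F = ?D S ?F" "S = \<tau> \<or> S = tl \<tau>" for L F S
    using that \<sigma> D\<tau> sub by (intro can_finish_imp_subline_swaps[OF that(1)]) auto
  have "can_finish [] ?F (s # \<tau>) \<or>
      (\<exists>x \<in> set A. can_finish [x] (removeAll x ?F) (s # \<tau>))"
    using at_most_one_taken_off[of "[]" A "s # \<tau>"] A \<sigma> fin by simp
  then consider "can_finish [] ?F (s # \<tau>)"
    | x where "x \<in> set A" "can_finish [x] (removeAll x ?F) (s # \<tau>)" by blast
  then show ?thesis
  proof cases
    case 1
    then show ?thesis using A by (auto intro: gen)
  next
    case 2
    have rem: "?D S (removeAll x ?F) = ?D S ?F" if "x \<notin> set S" for S
      using that by (auto simp: removeAll_filter_not_eq intro!: filter_cong)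
    have dF: "distinct (removeAll x ?F)" using A by (simp add: distinct_removeAll)
    show ?thesis
    proof (cases "x = s")
      case True
      then have "x \<notin> set \<tau>" "x \<notin> set (tl \<tau>)" using \<sigma> sub by auto
      then show ?thesis using 2 dF rem by (auto intro!: gen)
    next
      case False
      then have "x \<in> set \<tau>" using 2(1) \<sigma> by auto
      then obtain G \<tau>' where G: "removeAll x ?F = s # G" "\<tau> = x # \<tau>'"
        using 2 \<sigma> by (auto elim!: waiting_forced)
      show ?thesis
      proof (cases "s = last A")
        case True
        have "x \<notin> set (tl \<tau>)" using \<sigma> G by auto
        then show ?thesis using 2 dF rem True by (auto intro!: gen)
      next
        case False
        obtain B m where B: "A = B @ [m]" using 2(1) by (cases A rule: rev_cases) auto
        have "x = m" using False G(1) by (auto simp: B split: if_splits)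
        then have "rev B = s # G" using G(1) A by (simp add: B removeAll_id)
        have "subline_swaps G \<tau>'"
        proof (rule can_finish_imp_subline_swaps[OF 2(2)])
          show "?D \<tau>' (s # \<tau>) = \<tau>'" using \<sigma> by (auto simp: G filter_id_conv)
          show "?D \<tau>' (removeAll x ?F) = ?D \<tau>' G" using \<sigma> by (auto simp: G)
          show "set \<tau>' \<subseteq> set G"
          proof -
            have "set \<tau>' \<subseteq> set (removeAll x ?F) - {s}"
              using \<sigma> unfolding G(2) set_removeAll set_rev by auto
            then show ?thesis unfolding G(1) by auto
          qed
        qed (use \<sigma> G dF in auto)
        then have "adjacent_swaps (?D \<tau>' G) \<tau>'" by (simp add: subline_swaps_def)
        then have "adjacent_swaps (x # ?D \<tau>' G) (x # \<tau>')" by (rule adjacent_swaps.keep)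
        moreover have "?D \<tau> ?F = x # ?D \<tau>' G"
        proof -
          have "x \<notin> set (removeAll x ?F)" by simp
          then have "x \<notin> set G" unfolding G(1) by simp
          moreover have "s \<notin> set \<tau>" using \<sigma> by simp
          ultimately show ?thesis using \<open>rev B = s # G\<close> \<open>x = m\<close>
            by (auto simp: B G(2) intro!: filter_cong)
        qed
        ultimately show ?thesis using False by (simp add: subline_swaps_def G)
      qed
    qed
  qed
qed

text \<open>If \<open>s\<close> is not the last color of \<open>A\<close>, let its first sock wait on the left: this clears \<open>s\<close> before
  the rest of \<open>\<tau>\<close> arrives. If \<open>s\<close> is the last color, it lies outermost anyway, and one can instead
  let the color \<open>x\<close> that arrives second wait; the pair of \<open>s\<close> stays on the foot until \<open>x\<close> is
  complete. This is why one more entry is free in that case.\<close>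

lemma swaps_imp_can_finish_repeated_line:
  assumes A: "distinct A" and \<sigma>: "distinct (s # \<tau>)" "set (s # \<tau>) = set A"
    and swaps: "subline_swaps (rev A) (if s = last A then tl \<tau> else \<tau>)"
  shows "can_finish [] [] (A @ s # \<tau>)"
proof -
  let ?D = "\<lambda>S. filter (\<lambda>c. c \<in> set S)"
  have base: "can_finish [] (?D S (rev A)) S" if "subline_swaps (rev A) S" for S
    using that A by (intro adjacent_swaps_imp_can_finish) (auto simp: subline_swaps_def)
  have pair: "sorted_socks [c, c]" for c :: 'a by (auto simp: sorted_socks_def less_Suc_eq)
  show ?thesis
  proof (cases "s = last A")
    case False
    obtain B C where BC: "A = B @ s # C" using \<sigma>(2) by (metis list.set_intros(1) split_list)
    have "set \<tau> = set B \<union> set C" using A \<sigma> unfolding BC by (simp add: insert_ident)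
    then have "?D \<tau> (rev A) = rev C @ rev B"
      using A \<sigma> unfolding BC by (auto simp: filter_id_conv)
    then have "can_finish [] (rev C @ rev B) \<tau>" using base[of \<tau>] swaps False by simp
    then have "can_finish [s, s] (rev C @ rev B) \<tau>"
      using A \<sigma> pair unfolding BC by - (rule can_finish_prepend, auto)
    then have "can_finish [s] (rev C @ rev B) (s # \<tau>)"
      using can_finish_take_off[of "[s]" s] can_finish_put_on[of "[s]" s] by simp
    then have "can_finish [s] (rev B) (C @ s # \<tau>)" by (rule can_finish_put_on_all)
    then have "can_finish [] (s # rev B) (C @ s # \<tau>)"
      using can_finish_take_off[of "[]" s] by simp
    then show ?thesis
      using can_finish_put_on_all[of "[]" "B @ [s]" "[]" "C @ s # \<tau>"] by (simp add: BC)
  next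
    case True
    obtain A' where A': "A = A' @ [s]" using True \<sigma> by (cases A rule: rev_cases) auto
    show ?thesis
    proof (cases \<tau>)
      case Nil
      then have "A' = []" using A \<sigma> unfolding A' by (cases A') auto
      have "can_finish [] [] ([] :: 'a list)" by (auto simp: can_finish_def sorted_socks_def)
      then have "adjacent_swaps [s] [s]" by (intro adjacent_swaps.intros)
      then have "can_finish [] [s] [s]" by (rule adjacent_swaps_imp_can_finish) simp
      then show ?thesis using \<open>A' = []\<close> Nil can_finish_put_on[of "[]" s "[]" "[s]"] by (simp add: A')
    next
      case \<tau>: (Cons x \<tau>')
      have "x \<in> set A'" using \<sigma> unfolding \<tau> A' by auto
      then obtain B C where BC: "A' = B @ x # C" by (metis split_list)
      have "set \<tau>' = set B \<union> set C"
        using A \<sigma> unfolding A' BC \<tau> by (simp add: insert_ident insert_commute[of s x "set \<tau>'"])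
      then have "?D \<tau>' (rev A) = rev C @ rev B"
        using A \<sigma> unfolding A' BC \<tau> by (auto simp: filter_id_conv)
      then have fin: "can_finish [] (rev C @ rev B) \<tau>'" using base[of \<tau>'] swaps True \<tau> by simp
      have "sorted_socks ([x, x] @ [s, s])"
        using \<sigma> pair unfolding \<tau> by (intro sorted_socks_append) auto
      with fin have "can_finish [x, x, s, s] (rev C @ rev B) \<tau>'"
        using A \<sigma> unfolding A' BC \<tau> by - (rule can_finish_prepend, auto)
      then have "can_finish [x] (x # s # s # rev C @ rev B) \<tau>'"
        using can_finish_take_off[of "[x]" x] can_finish_take_off[of "[x, x]" s]
          can_finish_take_off[of "[x, x, s]" s] by simp
      then have "can_finish [x] (rev (C @ [s, s, x]) @ rev B) \<tau>'" by simp
      then have "can_finish [x] (rev B) (C @ [s, s, x] @ \<tau>')"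
        using can_finish_put_on_all[of "[x]" "C @ [s, s, x]"] by simp
      then have "can_finish [] (x # rev B) (C @ [s, s, x] @ \<tau>')"
        using can_finish_take_off[of "[]" x] by simp
      then show ?thesis
        using can_finish_put_on_all[of "[]" "B @ [x]" "[]" "C @ [s, s, x] @ \<tau>'"]
        by (simp add: A' BC \<tau>)
    qed
  qed
qed

section \<open>Pattern avoidance\<close>

lemma contains_pattern_3:
  "contains_pattern p [u, v, w] \<longleftrightarrow>
     (\<exists>a b c. subseq [a, b, c] p \<and>
        (a < b \<longleftrightarrow> u < v) \<and> (b < a \<longleftrightarrow> v < u) \<and> (a < c \<longleftrightarrow> u < w) \<and>
        (c < a \<longleftrightarrow> w < u) \<and> (b < c \<longleftrightarrow> v < w) \<and> (c < b \<longleftrightarrow> w < v))"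
  (is "?L \<longleftrightarrow> ?R")
proof
  assume ?L
  then obtain t where t: "subseq t p" "length t = 3"
    "\<And>i j. i < 3 \<Longrightarrow> j < 3 \<Longrightarrow> t ! i < t ! j \<longleftrightarrow> [u, v, w] ! i < [u, v, w] ! j"
    by (auto simp: contains_pattern_def)
  then obtain a b c where abc: "t = [a, b, c]"
    by (auto simp: length_Suc_conv numeral_3_eq_3)
  show ?R using t(1) t(3)[of 0 1] t(3)[of 1 0] t(3)[of 0 2] t(3)[of 2 0] t(3)[of 1 2] t(3)[of 2 1]
    unfolding abc by (intro exI[of _ a] exI[of _ b] exI[of _ c]) simp
next
  assume ?R
  then show ?L unfolding contains_pattern_def
    by (elim exE) (rule_tac x = "[a, b, c]" in exI, auto simp: less_Suc_eq)
qed

lemma avoids_all_iff: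
  "avoids_all p {[1, 2, 3], [1, 3, 2], [2, 1, 3]} \<longleftrightarrow>
     (\<forall>a b c. subseq [a, b, c] p \<longrightarrow>
        \<not> (a < b \<and> b < c) \<and> \<not> (a < c \<and> c < b) \<and> \<not> (b < a \<and> a < c))"
proof -
  have "contains_pattern p [1, 2, 3] \<longleftrightarrow> (\<exists>a b c. subseq [a, b, c] p \<and> a < b \<and> b < c)"
    unfolding contains_pattern_3 by (rule iff_exI, rule iff_exI, rule iff_exI) auto
  moreover have "contains_pattern p [1, 3, 2] \<longleftrightarrow> (\<exists>a b c. subseq [a, b, c] p \<and> a < c \<and> c < b)"
    unfolding contains_pattern_3 by (rule iff_exI, rule iff_exI, rule iff_exI) auto
  moreover have "contains_pattern p [2, 1, 3] \<longleftrightarrow> (\<exists>a b c. subseq [a, b, c] p \<and> b < a \<and> a < c)"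
    unfolding contains_pattern_3 by (rule iff_exI, rule iff_exI, rule iff_exI) auto
  ultimately show ?thesis unfolding avoids_all_def by blast
qed

lemma subseq_set: "subseq t p \<Longrightarrow> x \<in> set t \<Longrightarrow> x \<in> set p"
  using list_emb_set[of "(=)" t p x] by auto

text \<open>All three patterns have a larger entry to the right of their first entry, so a maximal first
  entry takes part in none of them.\<close>

lemma avoids_all_Cons_top:
  assumes "avoids_all R {[1, 2, 3], [1, 3, 2], [2, 1, 3]}" "\<And>c. c \<in> set R \<Longrightarrow> c < m"
  shows "avoids_all (m # R) {[1, 2, 3], [1, 3, 2], [2, 1, 3]}"
  unfolding avoids_all_iff
proof (intro allI impI)
  fix a b c
  assume sub: "subseq [a, b, c] (m # R)"
  show "\<not> (a < b \<and> b < c) \<and> \<not> (a < c \<and> c < b) \<and> \<not> (b < a \<and> a < c)"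
  proof (cases "a = m")
    case True
    then have "subseq [b, c] R" using sub by simp
    then have "b < m" "c < m" using subseq_set[of "[b, c]" R] assms(2) by auto
    then show ?thesis using True by simp
  next
    case False
    then have "subseq [a, b, c] R" using sub by simp
    then show ?thesis using assms(1) unfolding avoids_all_iff by blast
  qed
qed

text \<open>In each of the patterns the third entry exceeds the first. After \<open>l\<close> only \<open>m\<close> is larger, and
  with \<open>l\<close> as first entry, \<open>m\<close> comes too early to be the third.\<close>

lemma avoids_all_Cons_top_swapped:
  assumes "avoids_all R {[1, 2, 3], [1, 3, 2], [2, 1, 3]}"
    and "\<And>c. c \<in> set R \<Longrightarrow> c < l" "l < m"
  shows "avoids_all (l # m # R) {[1, 2, 3], [1, 3, 2], [2, 1, 3]}"
  unfolding avoids_all_iff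
proof (intro allI impI)
  fix a b c
  assume sub: "subseq [a, b, c] (l # m # R)"
  have mR: "avoids_all (m # R) {[1, 2, 3], [1, 3, 2], [2, 1, 3]}"
    using assms by (intro avoids_all_Cons_top) fastforce+
  show "\<not> (a < b \<and> b < c) \<and> \<not> (a < c \<and> c < b) \<and> \<not> (b < a \<and> a < c)"
  proof (cases "a = l")
    case True
    then have bc: "subseq [b, c] (m # R)" using sub by simp
    then have "subseq [c] R" by (cases "b = m") (auto dest: subseq_Cons')
    then have "c < l" using assms(2) by (simp add: subseq_singleton_left)
    then show ?thesis using True by simp
  next
    case False
    then have "subseq [a, b, c] (m # R)" using sub by simp
    then show ?thesis using mR unfolding avoids_all_iff by blast
  qed
qed

lemma adjacent_swaps_imp_avoids_all:
  assumes "adjacent_swaps F R" "sorted_wrt (>) F"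
  shows "avoids_all R {[1, 2, 3], [1, 3, 2], [2, 1, 3]}"
  using assms
proof (induction rule: adjacent_swaps.induct)
  case Nil
  then show ?case unfolding avoids_all_iff by simp
next
  case (keep F R m)
  then show ?case using adjacent_swaps_set[OF keep.hyps] by (intro avoids_all_Cons_top) simp_all
next
  case (swap F R m l)
  then show ?case
    using adjacent_swaps_set[OF swap.hyps] by (intro avoids_all_Cons_top_swapped) simp_all
qed

text \<open>Let \<open>m\<close> be the maximum. Two entries before \<open>m\<close> would form 123 or 213 with it, so \<open>m\<close> is first or
  second. If it is second, a later entry above the first one would complete 132, so the first
  entry is the second largest.\<close>

lemma avoids_all_imp_adjacent_swaps:
  assumes "avoids_all R {[1, 2, 3], [1, 3, 2], [2, 1, 3]}"
    and "sorted_wrt (>) F" "distinct R" "set R = set F"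
  shows "adjacent_swaps F R"
  using assms
proof (induction "length F" arbitrary: F R rule: less_induct)
  case less
  have av: "\<not> (a < b \<and> b < c)" "\<not> (a < c \<and> c < b)" "\<not> (b < a \<and> a < c)"
    if "subseq [a, b, c] R" for a b c
    using less.prems(1) that unfolding avoids_all_iff by blast+
  have av_sub: "avoids_all S {[1, 2, 3], [1, 3, 2], [2, 1, 3]}" if "subseq S R" for S
    using less.prems(1) that subseq_order.order_trans unfolding avoids_all_iff by blast
  show ?case
  proof (cases F)
    case Nil
    then show ?thesis using less.prems by (auto intro: adjacent_swaps.Nil)
  next
    case F: (Cons m F')
    then obtain r R' where R: "R = r # R'" using less.prems by (cases R) auto
    have below: "c < m" if "c \<in> set F'" for c using that less.prems unfolding F by auto
    then have m: "m \<notin> set F'" by auto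
    show ?thesis
    proof (cases "r = m")
      case True
      then have "set R' = set F'" using less.prems m unfolding F R by (simp add: insert_ident)
      then have "adjacent_swaps F' R'"
        using less.prems True av_sub[of R'] unfolding R by (intro less.hyps) (auto simp: F)
      then show ?thesis unfolding F R True by (rule adjacent_swaps.keep)
    next
      case False
      then have "r \<in> set F'" "m \<in> set R'" using less.prems unfolding F R by auto
      then obtain f F'' s R'' where FR: "F' = f # F''" "R' = s # R''"
        by (cases F'; cases R') auto
      have "s = m"
      proof (rule ccontr)
        assume "s \<noteq> m"
        then have "subseq [r, s, m] R" using \<open>m \<in> set R'\<close>
          by (auto simp: R FR subseq_singleton_left)
        moreover have "s \<in> set F'" "s \<noteq> r" using \<open>s \<noteq> m\<close> less.prems unfolding F R FR by auto
        ultimately show False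
          using av[of r s m] below[of r] below[of s] \<open>r \<in> set F'\<close> by auto
      qed
      have "r = f"
      proof (rule ccontr)
        assume "r \<noteq> f"
        then have "f \<in> set R''" using less.prems \<open>s = m\<close> m unfolding F R FR by auto
        then have "subseq [r, m, f] R" by (auto simp: R FR \<open>s = m\<close> subseq_singleton_left)
        moreover have "r < f" using \<open>r \<noteq> f\<close> \<open>r \<in> set F'\<close> less.prems unfolding F FR by auto
        ultimately show False using av[of r m f] below[of f] FR by auto
      qed
      have "f \<notin> set F''" using less.prems unfolding F FR by auto
      then have "set R'' = set F''"
        using less.prems m \<open>s = m\<close> \<open>r = f\<close> unfolding F R FR
        by (simp add: insert_ident insert_commute)
      then have "adjacent_swaps F'' R''"
        using less.prems av_sub[of R''] unfolding R FR by (intro less.hyps) (auto simp: F FR)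
      then show ?thesis unfolding F R FR \<open>s = m\<close> \<open>r = f\<close> by (rule adjacent_swaps.swap)
    qed
  qed
qed

lemma subline_swaps_iff_avoids_all:
  assumes "sorted_wrt (>) F" "distinct R" "set R \<subseteq> set F"
  shows "subline_swaps F R \<longleftrightarrow> avoids_all R {[1, 2, 3], [1, 3, 2], [2, 1, 3]}"
proof -
  have "sorted_wrt (>) (filter (\<lambda>c. c \<in> set R) F)" using assms(1) by (rule sorted_wrt_filter)
  moreover have "set R = set (filter (\<lambda>c. c \<in> set R) F)" using assms(3) by auto
  ultimately show ?thesis unfolding subline_swaps_def
    using adjacent_swaps_imp_avoids_all avoids_all_imp_adjacent_swaps assms(2) by blast
qed

lemma adjacent_swaps_Nil_iff: "adjacent_swaps [] R \<longleftrightarrow> R = []"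
  by (subst adjacent_swaps.simps) auto

lemma adjacent_swaps_single_iff: "adjacent_swaps [x] R \<longleftrightarrow> R = [x]"
  by (subst adjacent_swaps.simps) (auto simp: adjacent_swaps_Nil_iff)

lemma adjacent_swaps_Cons_Cons_iff:
  "adjacent_swaps (x # y # F) R \<longleftrightarrow>
     (\<exists>S. R = x # S \<and> adjacent_swaps (y # F) S) \<or> (\<exists>S. R = y # x # S \<and> adjacent_swaps F S)"
  by (subst adjacent_swaps.simps) auto

text \<open>The Fibonacci recursion: the first entry of \<open>F\<close> is either kept or exchanged with the second.\<close>

lemma card_adjacent_swaps:
  assumes "distinct F"
  shows "finite {R. adjacent_swaps F R} \<and> card {R. adjacent_swaps F R} = fib (Suc (length F))"
  using assms
proof (induction F rule: induct_list012)
  case 1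
  then show ?case by (simp add: adjacent_swaps_Nil_iff)
next
  case (2 x)
  then show ?case by (simp add: adjacent_swaps_single_iff)
next
  case (3 x y F)
  let ?X = "{R. adjacent_swaps (y # F) R}" and ?Y = "{R. adjacent_swaps F R}"
  have eq: "{R. adjacent_swaps (x # y # F) R} = (#) x ` ?X \<union> (\<lambda>R. y # x # R) ` ?Y"
    by (auto simp: adjacent_swaps_Cons_Cons_iff)
  have "card ((#) x ` ?X \<union> (\<lambda>R. y # x # R) ` ?Y) = card ((#) x ` ?X) + card ((\<lambda>R. y # x # R) ` ?Y)"
    using 3 by (intro card_Un_disjoint) auto
  also have "\<dots> = card ?X + card ?Y" by (simp add: card_image inj_on_def)
  finally show ?case using 3 unfolding eq by simp
qed

section \<open>Sock orderings and permutations\<close>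

lemma sock_ordering_of_image:
  "sock_ordering_of w = (\<lambda>c. {i \<in> {1..length w}. w ! (i - 1) = c}) ` set w"
  unfolding sock_ordering_of_def by (rule Setcompr_eq_image)

lemma same_block_sock_ordering_of:
  "(\<exists>B\<in>sock_ordering_of w. i \<in> B \<and> j \<in> B) \<longleftrightarrow>
     i \<in> {1..length w} \<and> j \<in> {1..length w} \<and> w ! (i - 1) = w ! (j - 1)"
  by (auto simp: sock_ordering_of_image)

lemma partition_on_sock_ordering_of: "partition_on {1..length w} (sock_ordering_of w)"
proof (rule partition_onI)
  show "\<Union> (sock_ordering_of w) = {1..length w}"
    by (auto simp: sock_ordering_of_image)
  show "{} \<notin> sock_ordering_of w"
  proof
    assume "{} \<in> sock_ordering_of w"
    then obtain c where c: "{} = {i \<in> {1..length w}. w ! (i - 1) = c}" "c \<in> set w"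
      unfolding sock_ordering_of_image by (rule imageE)
    then obtain k where "k < length w" "w ! k = c" by (auto simp: in_set_conv_nth)
    then have "Suc k \<in> {}" unfolding c by simp
    then show False by blast
  qed
qed (auto simp: sock_ordering_of_image disjnt_def)

text \<open>A partition is determined by the relation of lying in a common block.\<close>

lemma sock_ordering_of_eqI:
  assumes \<rho>: "partition_on {1..length w} \<rho>"
    and rel: "\<And>i j. i \<in> {1..length w} \<Longrightarrow> j \<in> {1..length w} \<Longrightarrow>
      (\<exists>B\<in>\<rho>. i \<in> B \<and> j \<in> B) \<longleftrightarrow> w ! (i - 1) = w ! (j - 1)"
  shows "sock_ordering_of w = \<rho>"
proof -
  have "B \<subseteq> {1..length w}" if "B \<in> \<rho>" for B using \<rho> that by (auto simp: partition_on_def)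
  then have "(\<exists>B\<in>\<rho>. i \<in> B \<and> j \<in> B) \<longleftrightarrow>
      i \<in> {1..length w} \<and> j \<in> {1..length w} \<and> w ! (i - 1) = w ! (j - 1)" for i j
    using rel by (meson subsetD)
  then have "{(i, j). \<exists>B\<in>\<rho>. i \<in> B \<and> j \<in> B} = {(i, j). \<exists>B\<in>sock_ordering_of w. i \<in> B \<and> j \<in> B}"
    unfolding same_block_sock_ordering_of by auto
  then show ?thesis
    using partition_on_eq_quotient[OF \<rho>] partition_on_eq_quotient[OF partition_on_sock_ordering_of[of w]]
    by simp
qed

lemma sock_ordering_of_eqD:
  assumes "sock_ordering_of v = sock_ordering_of w"
  shows "length v = length w"
    and "i < length v \<Longrightarrow> j < length v \<Longrightarrow> v ! i = v ! j \<longleftrightarrow> w ! i = w ! j"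
proof -
  have "{1..length v} = {1..length w}"
    using partition_on_sock_ordering_of[of v] partition_on_sock_ordering_of[of w] assms
    by (simp add: partition_on_def)
  then show len: "length v = length w" by (metis card_atLeastAtMost diff_Suc_1)
  show "v ! i = v ! j \<longleftrightarrow> w ! i = w ! j" if "i < length v" "j < length v"
    using same_block_sock_ordering_of[of v "Suc i" "Suc j"]
      same_block_sock_ordering_of[of w "Suc i" "Suc j"] that assms len by simp
qed

lemma sock_ordering_of_eq_imp_renaming:
  assumes "sock_ordering_of v = sock_ordering_of w"
  shows "\<exists>f. inj_on f (set v) \<and> map f v = w"
proof -
  note eq = sock_ordering_of_eqD[OF assms]
  define pos where "pos c = (SOME i. i < length v \<and> v ! i = c)" for c
  define f where "f c = w ! pos c" for c
  have pos: "pos c < length v \<and> v ! pos c = c" if "c \<in> set v" for c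
    unfolding pos_def by (rule someI_ex) (use that in \<open>auto simp: in_set_conv_nth\<close>)
  have "inj_on f (set v)"
    by (rule inj_onI) (metis f_def pos eq(2))
  moreover have "map f v = w"
  proof (rule nth_equalityI)
    show "map f v ! i = w ! i" if "i < length (map f v)" for i
      using that eq(2)[of "pos (v ! i)" i] pos[of "v ! i"] by (simp add: f_def)
  qed (simp add: eq)
  ultimately show ?thesis by blast
qed

text \<open>The existential choice of a representing line in \<^const>\<open>foot_sortable\<close> is immaterial, since any two
  such lines differ by an injective renaming of colors.\<close>

lemma foot_sortable_sock_ordering_of:
  fixes w :: "nat list"
  shows "foot_sortable (sock_ordering_of w) \<longleftrightarrow> can_finish [] [] w"
proof
  assume "foot_sortable (sock_ordering_of w)"
  then obtain v :: "nat list" where v: "sock_ordering_of v = sock_ordering_of w" "can_finish [] [] v"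
    by (auto simp: foot_sortable_def can_finish_def)
  then show "can_finish [] [] w"
    using sock_ordering_of_eq_imp_renaming[OF v(1)] can_finish_map by blast
qed (auto simp: foot_sortable_def can_finish_def)

definition perm_ordering :: "nat \<Rightarrow> nat list \<Rightarrow> nat set set" where
  "perm_ordering n \<sigma> = sock_ordering_of ([1..<Suc n] @ \<sigma>)"

lemma nth_perm_word:
  "i \<in> {1..n} \<Longrightarrow> ([1..<Suc n] @ \<sigma>) ! (i - 1) = i"
  "n < i \<Longrightarrow> ([1..<Suc n] @ \<sigma>) ! (i - 1) = \<sigma> ! (i - Suc n)"
  by (auto simp: nth_append simp del: upt_Suc)

lemma inj_on_perm_ordering: "inj_on (perm_ordering n) (permutations_of_set {1..n})"
proof (rule inj_onI)
  fix \<sigma> \<tau>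
  assume \<sigma>: "\<sigma> \<in> permutations_of_set {1..n}" and \<tau>: "\<tau> \<in> permutations_of_set {1..n}"
    and eq: "perm_ordering n \<sigma> = perm_ordering n \<tau>"
  have len: "length \<sigma> = n" "length \<tau> = n"
    using \<sigma> \<tau> length_finite_permutations_of_set by force+
  show "\<sigma> = \<tau>"
  proof (rule nth_equalityI)
    fix j assume j: "j < length \<sigma>"
    then have c: "\<sigma> ! j \<in> {1..n}" using \<sigma> by (metis nth_mem permutations_of_setD(1))
    then have "\<sigma> ! j - 1 < 2 * n" by auto
    then have "([1..<Suc n] @ \<tau>) ! (\<sigma> ! j - 1) = ([1..<Suc n] @ \<tau>) ! (n + j)"
      using sock_ordering_of_eqD(2)[OF eq[unfolded perm_ordering_def], of "\<sigma> ! j - 1" "n + j"]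
        j nth_perm_word(1)[OF c, of \<sigma>]
      by (simp add: nth_append len del: upt_Suc One_nat_def)
    then show "\<sigma> ! j = \<tau> ! j"
      unfolding nth_perm_word(1)[OF c, of \<tau>] by (simp add: nth_append del: upt_Suc)
  qed (simp add: len)
qed

lemma perm_ordering_alignment_free:
  assumes "\<sigma> \<in> permutations_of_set {1..n}"
  shows "alignment_free_2_uniform n (perm_ordering n \<sigma>)"
proof -
  let ?w = "[1..<Suc n] @ \<sigma>"
  have \<sigma>: "set \<sigma> = {1..n}" "distinct \<sigma>" and len: "length \<sigma> = n"
    using assms length_finite_permutations_of_set[OF assms] by (auto dest: permutations_of_setD)
  have lw: "length ?w = 2 * n" by (simp add: len)
  have part: "sock_ordering (2 * n) (perm_ordering n \<sigma>)"
    using partition_on_sock_ordering_of[of ?w] lw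
    by (simp only: sock_ordering_def perm_ordering_def)
  have card2: "card B = 2" if "B \<in> perm_ordering n \<sigma>" for B
  proof -
    from that obtain c where c: "B = {i \<in> {1..length ?w}. ?w ! (i - 1) = c}" "c \<in> set ?w"
      by (auto simp: perm_ordering_def sock_ordering_of_image)
    then have "c \<in> {1..n}" using \<sigma> by auto
    moreover from this obtain j where j: "j < n" "\<sigma> ! j = c"
      using \<sigma>(1) len by (metis in_set_conv_nth)
    moreover have "i = c \<or> i = n + Suc j" if i: "i \<in> B" for i
    proof (cases "i \<le> n")
      case True
      then show ?thesis using i nth_perm_word(1)[of i n \<sigma>] unfolding c by auto
    next
      case False
      then have "\<sigma> ! (i - Suc n) = \<sigma> ! j" "i - Suc n < n"
        using i nth_perm_word(2)[of n i \<sigma>] j unfolding c by (auto simp: len)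
      then have "i - Suc n = j" using \<sigma>(2) j(1) len by (simp add: nth_eq_iff_index_eq)
      then show ?thesis using False by auto
    qed
    moreover have "c \<in> B" "n + Suc j \<in> B"
      using \<open>c \<in> {1..n}\<close> j nth_perm_word(1)[of c n \<sigma>] nth_perm_word(2)[of n "n + Suc j" \<sigma>]
      unfolding c by (auto simp: len)
    ultimately have "B = {c, n + Suc j}" "c \<noteq> n + Suc j" by auto
    then show ?thesis by simp
  qed
  have "i = j" if "B \<in> perm_ordering n \<sigma>" "i \<in> B" "j \<in> B" "i \<le> n" "j \<le> n" for B i j
  proof -
    have "\<exists>B \<in> sock_ordering_of ?w. i \<in> B \<and> j \<in> B" using that unfolding perm_ordering_def by blast
    then have "i \<in> {1..n}" "j \<in> {1..n}" "?w ! (i - 1) = ?w ! (j - 1)"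
      unfolding same_block_sock_ordering_of using that(4,5) by auto
    then show ?thesis by (simp only: nth_perm_word)
  qed
  then show ?thesis using part card2
    by (auto simp: alignment_free_2_uniform_def two_uniform_def alignment_free_def)
qed

text \<open>There are \<open>n\<close> blocks of size 2, and the first \<open>n\<close> positions lie in different blocks, so they
  meet every block exactly once.\<close>

lemma alignment_free_block:
  assumes "alignment_free_2_uniform n \<rho>" "B \<in> \<rho>"
  obtains i j where "B = {i, j}" "i \<in> {1..n}" "j \<in> {Suc n..2 * n}"
proof -
  have part: "partition_on {1..2 * n} \<rho>" and two: "\<And>B. B \<in> \<rho> \<Longrightarrow> card B = 2"
    and af: "\<And>B i j. B \<in> \<rho> \<Longrightarrow> i \<in> B \<Longrightarrow> j \<in> B \<Longrightarrow> i \<le> n \<Longrightarrow> j \<le> n \<Longrightarrow> i = j"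
    using assms(1)
    by (auto simp: alignment_free_2_uniform_def sock_ordering_def two_uniform_def alignment_free_def)
  have U: "\<Union>\<rho> = {1..2 * n}" using part by (simp add: partition_on_def)
  have fin: "finite \<rho>" by (rule finite_elements[OF _ part]) simp
  have "2 * card \<rho> = card (\<Union>\<rho>)"
    using part two fin U by (intro card_partition) (auto simp: partition_on_def disjoint_def)
  then have card\<rho>: "card \<rho> = n" unfolding U by simp
  have "\<exists>b. b \<in> \<rho> \<and> i \<in> b" if "i \<in> {1..n}" for i
  proof -
    have "i \<in> \<Union>\<rho>" using that unfolding U by auto
    then show ?thesis by blast
  qed
  then obtain blk where blk: "\<And>i. i \<in> {1..n} \<Longrightarrow> blk i \<in> \<rho> \<and> i \<in> blk i" by metis
  have "inj_on blk {1..n}"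
    by (rule inj_onI) (metis af blk atLeastAtMost_iff)
  then have "card (blk ` {1..n}) = card \<rho>" using card\<rho> by (simp add: card_image)
  then have "blk ` {1..n} = \<rho>" using blk fin by (intro card_subset_eq) auto
  then obtain i where i: "i \<in> {1..n}" "i \<in> B" using assms(2) blk by blast
  obtain j where j: "B = {i, j}" "j \<noteq> i"
    using two[OF assms(2)] i(2) by (auto simp: card_2_iff)
  have "j \<in> \<Union>\<rho>" using j assms(2) by auto
  moreover have "\<not> j \<le> n" using af[OF assms(2), of i j] i j by auto
  ultimately show thesis using that[OF j(1) i(1)] unfolding U by auto
qed

lemma alignment_free_imp_perm_ordering:
  assumes \<rho>: "alignment_free_2_uniform n \<rho>"
  shows "\<exists>\<sigma> \<in> permutations_of_set {1..n}. perm_ordering n \<sigma> = \<rho>"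
proof -
  have part: "partition_on {1..2 * n} \<rho>"
    using \<rho> by (simp add: alignment_free_2_uniform_def sock_ordering_def)
  have U: "\<Union>\<rho> = {1..2 * n}" using part by (simp add: partition_on_def)
  have same: "B = C" if "B \<in> \<rho>" "C \<in> \<rho>" "x \<in> B" "x \<in> C" for B C x
    using part that by (auto simp: partition_on_def disjoint_def)
  have "\<exists>i. i \<in> {1..n} \<and> {i, n + Suc j} \<in> \<rho>" if "j < n" for j
  proof -
    have "n + Suc j \<in> \<Union>\<rho>" using that unfolding U by auto
    then obtain B where B: "B \<in> \<rho>" "n + Suc j \<in> B" by blast
    from alignment_free_block[OF \<rho> B(1)] obtain i k where
      "B = {i, k}" "i \<in> {1..n}" "k \<in> {Suc n..2 * n}" .
    then show ?thesis using B by auto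
  qed
  \<comment> \<open>\<open>g j\<close> is the color at position \<open>n + j + 1\<close>, named by its first position.\<close>
  then obtain g where g: "\<And>j. j < n \<Longrightarrow> g j \<in> {1..n} \<and> {g j, n + Suc j} \<in> \<rho>" by metis
  have inj: "j = k" if "j < n" "k < n" "g j = g k" for j k
  proof -
    have "{g j, n + Suc j} = {g k, n + Suc k}"
      using same[of "{g j, n + Suc j}" "{g k, n + Suc k}" "g j"] g[OF that(1)] g[OF that(2)] that(3)
      by auto
    then show ?thesis using g[OF that(1)] g[OF that(2)] by (auto simp: doubleton_eq_iff)
  qed
  define \<sigma> where "\<sigma> = map g [0..<n]"
  have len: "length \<sigma> = n" by (simp add: \<sigma>_def)
  have "inj_on g {0..<n}" by (rule inj_onI) (use inj in auto)
  then have dist: "distinct \<sigma>" by (simp add: \<sigma>_def distinct_map)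
  have "set \<sigma> \<subseteq> {1..n}" using g by (auto simp: \<sigma>_def)
  then have set\<sigma>: "set \<sigma> = {1..n}"
    using dist len by (intro card_subset_eq) (auto simp: distinct_card)
  let ?w = "[1..<Suc n] @ \<sigma>"
  have lw: "length ?w = 2 * n" by (simp add: len)
  have color: "\<exists>B \<in> \<rho>. i \<in> B \<and> ?w ! (i - 1) \<in> B \<and> ?w ! (i - 1) \<in> {1..n}" if "i \<in> {1..2 * n}" for i
  proof (cases "i \<le> n")
    case True
    then have "?w ! (i - 1) = i" "i \<in> {1..n}" using that nth_perm_word(1)[of i n \<sigma>] by auto
    moreover have "i \<in> \<Union>\<rho>" using that unfolding U by simp
    ultimately show ?thesis by auto
  next
    case False
    then have j: "i - Suc n < n" "n + Suc (i - Suc n) = i" using that by auto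
    then have color_i: "?w ! (i - 1) = g (i - Suc n)"
      using nth_perm_word(2)[of n i \<sigma>] False by (simp add: \<sigma>_def)
    have "g (i - Suc n) \<in> {1..n}" "{g (i - Suc n), i} \<in> \<rho>"
      using g[OF j(1)] unfolding j(2) by simp_all
    then show ?thesis unfolding color_i by (intro bexI[of _ "{g (i - Suc n), i}"]) simp_all
  qed
  have "perm_ordering n \<sigma> = \<rho>" unfolding perm_ordering_def
  proof (rule sock_ordering_of_eqI)
    show "partition_on {1..length ?w} \<rho>" unfolding lw by (rule part)
    fix i j assume "i \<in> {1..length ?w}" "j \<in> {1..length ?w}"
    then obtain B C where
      B: "B \<in> \<rho>" "i \<in> B" "?w ! (i - 1) \<in> B" "?w ! (i - 1) \<in> {1..n}" and
      C: "C \<in> \<rho>" "j \<in> C" "?w ! (j - 1) \<in> C" "?w ! (j - 1) \<in> {1..n}"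
      using color unfolding lw by meson
    have "B = C \<longleftrightarrow> ?w ! (i - 1) = ?w ! (j - 1)"
    proof
      assume "B = C"
      then show "?w ! (i - 1) = ?w ! (j - 1)"
        using \<rho> B C by (auto simp: alignment_free_2_uniform_def alignment_free_def)
    qed (use same B C in metis)
    moreover have "(\<exists>D\<in>\<rho>. i \<in> D \<and> j \<in> D) \<longleftrightarrow> B = C" using same B(1,2) C(1,2) by blast
    ultimately show "(\<exists>D\<in>\<rho>. i \<in> D \<and> j \<in> D) \<longleftrightarrow> ?w ! (i - 1) = ?w ! (j - 1)" by simp
  qed
  moreover have "\<sigma> \<in> permutations_of_set {1..n}" using set\<sigma> dist by (rule permutations_of_setI)
  ultimately show ?thesis by blast
qed

lemma sock_perm_perm_ordering:
  assumes "\<sigma> \<in> permutations_of_set {1..n}"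
  shows "sock_perm n (perm_ordering n \<sigma>) = \<sigma>"
  unfolding sock_perm_def perm_ordering_def[symmetric]
  using assms inj_on_perm_ordering by (auto simp: inj_on_def)

section \<open>Characterization and count\<close>

lemma foot_sortable_perm_ordering:
  assumes "s # \<tau> \<in> permutations_of_set {1..n}"
  shows "foot_sortable (perm_ordering n (s # \<tau>)) \<longleftrightarrow>
    subline_swaps (rev [1..<Suc n]) (if s = n then tl \<tau> else \<tau>)"
proof -
  have \<sigma>: "distinct (s # \<tau>)" "set (s # \<tau>) = set [1..<Suc n]"
    using permutations_of_setD[OF assms]
    by (simp_all add: atLeastLessThanSuc_atLeastAtMost del: upt_Suc)
  have "n \<noteq> 0" using \<sigma>(2) by (cases n) simp_all
  then have "last [1..<Suc n] = n" by simp
  then show ?thesis unfolding perm_ordering_def foot_sortable_sock_ordering_of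
    using can_finish_repeated_line_imp_swaps[OF _ \<sigma>] swaps_imp_can_finish_repeated_line[OF _ \<sigma>]
    by (metis distinct_upt)
qed

text \<open>A first entry \<open>s < n\<close> is followed by one of \<open>fib n\<close> arrangements of the other \<open>n - 1\<close> entries. If
  the first entry is \<open>n\<close>, the second entry \<open>x < n\<close> is free, and \<open>fib (n - 1)\<close> arrangements of the
  other \<open>n - 2\<close> entries may follow.\<close>

lemma card_foot_sortable_perms:
  assumes "n \<ge> 2"
  shows "card {\<sigma> \<in> permutations_of_set {1..n}. foot_sortable (perm_ordering n \<sigma>)} =
    (n - 1) * fib (n + 1)"
proof -
  define F where "F = rev [1..<Suc n]"
  have F: "distinct F" "set F = {1..n}" "length F = n" by (auto simp: F_def simp del: upt_Suc)
  let ?swaps = "\<lambda>F. {\<tau>. adjacent_swaps F \<tau>}"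
  define X where "X = (SIGMA s : {1..<n}. ?swaps (removeAll s F))"
  define Y where "Y = (SIGMA x : {1..<n}. ?swaps (removeAll x (removeAll n F)))"
  have swaps: "adjacent_swaps G \<tau> \<longleftrightarrow> distinct \<tau> \<and> set \<tau> = set G \<and> subline_swaps F \<tau>"
    if "G = filter (\<lambda>c. c \<in> set G) F" for G \<tau>
  proof -
    have "distinct G" using that F(1) by (metis distinct_filter)
    then have "distinct \<tau> \<and> set \<tau> = set G" if "adjacent_swaps G \<tau>"
      using adjacent_swaps_set[OF that] adjacent_swaps_mset[OF that] by (metis mset_eq_imp_distinct_iff)
    then show ?thesis unfolding subline_swaps_def using that by metis
  qed
  have rem1: "removeAll s F = filter (\<lambda>c. c \<in> set (removeAll s F)) F" for s
    by (auto simp: removeAll_filter_not_eq intro!: filter_cong)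
  have rem2: "removeAll x (removeAll n F) = filter (\<lambda>c. c \<in> set (removeAll x (removeAll n F))) F" for x
    by (auto simp: removeAll_filter_not_eq intro!: filter_cong)
  have perm: "s # \<tau> \<in> permutations_of_set {1..n} \<longleftrightarrow>
      s \<in> {1..n} \<and> distinct \<tau> \<and> set \<tau> = {1..n} - {s}" for s \<tau>
  proof -
    have "insert s X = A \<and> s \<notin> X \<longleftrightarrow> s \<in> A \<and> X = A - {s}" for X A :: "nat set" by blast
    from this[of "set \<tau>" "{1..n}"] show ?thesis
      unfolding permutations_of_set_def mem_Collect_eq list.set distinct.simps by blast
  qed
  have perm2: "s # x # \<tau> \<in> permutations_of_set {1..n} \<longleftrightarrow>
      s \<in> {1..n} \<and> x \<in> {1..n} - {s} \<and> distinct \<tau> \<and> set \<tau> = {1..n} - {s} - {x}" for s x \<tau>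
    unfolding perm by (simp only: list.set distinct.simps) blast
  have "{\<sigma> \<in> permutations_of_set {1..n}. foot_sortable (perm_ordering n \<sigma>)} =
      (\<lambda>(s, \<tau>). s # \<tau>) ` X \<union> (\<lambda>(x, \<tau>). n # x # \<tau>) ` Y" (is "?S = ?X \<union> ?Y")
  proof (intro equalityI subsetI)
    fix \<sigma> assume "\<sigma> \<in> ?S"
    then have \<sigma>: "\<sigma> \<in> permutations_of_set {1..n}" "foot_sortable (perm_ordering n \<sigma>)" by auto
    have len: "length \<sigma> = n" using length_finite_permutations_of_set[OF \<sigma>(1)] by simp
    then obtain s x \<tau> where s: "\<sigma> = s # x # \<tau>" using assms
      by (metis Suc_le_length_iff numeral_2_eq_2)
    have sub: "subline_swaps F (if s = n then \<tau> else x # \<tau>)"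
      using foot_sortable_perm_ordering \<sigma> unfolding s F_def by (metis list.sel(3))
    show "\<sigma> \<in> ?X \<union> ?Y"
    proof (cases "s = n")
      case True
      then have "(x, \<tau>) \<in> Y" using sub \<sigma>(1) F
        unfolding Y_def s perm2 by (auto simp: swaps[OF rem2])
      then show ?thesis unfolding s True by (intro UnI2 image_eqI[of _ _ "(x, \<tau>)"]) auto
    next
      case False
      then have "(s, x # \<tau>) \<in> X" using sub \<sigma>(1) F
        unfolding X_def s perm by (auto simp: swaps[OF rem1])
      then show ?thesis unfolding s by (intro UnI1 image_eqI[of _ _ "(s, x # \<tau>)"]) auto
    qed
  next
    fix \<sigma> assume "\<sigma> \<in> ?X \<union> ?Y"
    then show "\<sigma> \<in> ?S"
    proof
      assume "\<sigma> \<in> ?X"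
      then obtain s \<tau> where s: "\<sigma> = s # \<tau>" "s \<in> {1..<n}" "adjacent_swaps (removeAll s F) \<tau>"
        by (auto simp: X_def)
      then have "\<sigma> \<in> permutations_of_set {1..n}" "subline_swaps F \<tau>"
        using F unfolding s(1) perm by (auto simp: swaps[OF rem1])
      then show ?thesis using foot_sortable_perm_ordering[of s \<tau> n] s(2) unfolding s(1) F_def by simp
    next
      assume "\<sigma> \<in> ?Y"
      then obtain x \<tau> where s: "\<sigma> = n # x # \<tau>" "x \<in> {1..<n}"
        "adjacent_swaps (removeAll x (removeAll n F)) \<tau>"
        by (auto simp: Y_def)
      then have "\<sigma> \<in> permutations_of_set {1..n}" "subline_swaps F \<tau>"
        using F unfolding s(1) perm2 by (auto simp: swaps[OF rem2])
      then show ?thesis using foot_sortable_perm_ordering[of n "x # \<tau>" n] unfolding s(1) F_def by simp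
    qed
  qed
  moreover have "card (?X \<union> ?Y) = card X + card Y" and "card X = (n - 1) * fib n"
    and "card Y = (n - 1) * fib (n - 1)"
  proof -
    have len1: "length (removeAll s F) = n - 1" "distinct (removeAll s F)" if "s \<in> {1..<n}" for s
      using that F by (auto simp: distinct_removeAll distinct_remove1_removeAll[symmetric] length_remove1)
    have len2: "length (removeAll x (removeAll n F)) = n - 2" "distinct (removeAll x (removeAll n F))"
      if "x \<in> {1..<n}" for x
      using that F by (auto simp: distinct_removeAll distinct_remove1_removeAll[symmetric] length_remove1)
    have swaps1: "finite (?swaps (removeAll s F)) \<and> card (?swaps (removeAll s F)) = fib n"
      if "s \<in> {1..<n}" for s
      using card_adjacent_swaps[OF len1(2)[OF that]] len1(1)[OF that] assms by simp
    have swaps2: "finite (?swaps (removeAll x (removeAll n F))) \<and>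
        card (?swaps (removeAll x (removeAll n F))) = fib (n - 1)" if "x \<in> {1..<n}" for x
      using card_adjacent_swaps[OF len2(2)[OF that]] len2(1)[OF that] assms
      by (simp add: Suc_diff_Suc numeral_2_eq_2)
    have finX: "finite X" unfolding X_def using swaps1 by (intro finite_SigmaI) blast+
    have finY: "finite Y" unfolding Y_def using swaps2 by (intro finite_SigmaI) blast+
    have "card (?X \<union> ?Y) = card ?X + card ?Y"
      using finX finY by (intro card_Un_disjoint) (auto simp: X_def Y_def)
    moreover have "inj_on (\<lambda>(s, \<tau>). s # \<tau>) X" "inj_on (\<lambda>(x, \<tau>). n # x # \<tau>) Y"
      by (auto simp: inj_on_def)
    ultimately show "card (?X \<union> ?Y) = card X + card Y" by (simp add: card_image)
    have "card X = (\<Sum>s\<in>{1..<n}. fib n)"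
      unfolding X_def using swaps1 by (subst card_SigmaI) (blast, blast, intro sum.cong, blast+)
    then show "card X = (n - 1) * fib n" by simp
    have "card Y = (\<Sum>x\<in>{1..<n}. fib (n - 1))"
      unfolding Y_def using swaps2 by (subst card_SigmaI) (blast, blast, intro sum.cong, blast+)
    then show "card Y = (n - 1) * fib (n - 1)" by simp
  qed
  moreover have "fib (n + 1) = fib n + fib (n - 1)"
    using assms by (cases n rule: fib.cases) auto
  ultimately show ?thesis by (simp add: distrib_left)
qed

theorem theorem1p2:
  fixes n :: nat
  assumes "n \<ge> 1"
  shows "(\<forall>\<rho>. alignment_free_2_uniform n \<rho> \<longrightarrow>
            (let \<sigma> = sock_perm n \<rho> in
               foot_sortable \<rho> \<longleftrightarrow>
                 \<sigma> ! 0 < n \<and> avoids_all (drop 1 \<sigma>) {[1,2,3], [1,3,2], [2,1,3]} \<or>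
                 \<sigma> ! 0 = n \<and> avoids_all (drop 2 \<sigma>) {[1,2,3], [1,3,2], [2,1,3]}))
         \<and> (n \<ge> 2 \<longrightarrow>
              card {\<rho>. alignment_free_2_uniform n \<rho> \<and> foot_sortable \<rho>} = (n - 1) * fib (n + 1))"
proof (intro conjI allI impI)
  fix \<rho> assume "alignment_free_2_uniform n \<rho>"
  then obtain \<sigma> where \<sigma>: "\<sigma> \<in> permutations_of_set {1..n}" "\<rho> = perm_ordering n \<sigma>"
    using alignment_free_imp_perm_ordering by blast
  have "\<sigma> \<noteq> []" using \<sigma>(1) assms by (auto dest: permutations_of_setD)
  then obtain s \<tau> where s: "\<sigma> = s # \<tau>" by (cases \<sigma>) auto
  have set: "set (s # \<tau>) = {1..n}" "distinct (s # \<tau>)"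
    using permutations_of_setD[OF \<sigma>(1)] unfolding s by blast+
  have sub: "set (tl \<tau>) \<subseteq> set \<tau>" by (cases \<tau>) auto
  have "sorted_wrt (>) (rev [1..<Suc n])" by (simp add: sorted_wrt_rev del: upt_Suc)
  then have av: "subline_swaps (rev [1..<Suc n]) S \<longleftrightarrow>
      avoids_all S {[1, 2, 3], [1, 3, 2], [2, 1, 3]}" if "distinct S" "set S \<subseteq> set \<tau>" for S
    using that set by (intro subline_swaps_iff_avoids_all) auto
  have "drop 1 \<sigma> = \<tau>" "drop 2 \<sigma> = tl \<tau>" "\<sigma> ! 0 = s" "s \<le> n" "distinct \<tau>" "distinct (tl \<tau>)"
    using set by (auto simp: s drop_Suc numeral_2_eq_2 distinct_tl)
  then show "let \<sigma> = sock_perm n \<rho> in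
               foot_sortable \<rho> \<longleftrightarrow>
                 \<sigma> ! 0 < n \<and> avoids_all (drop 1 \<sigma>) {[1,2,3], [1,3,2], [2,1,3]} \<or>
                 \<sigma> ! 0 = n \<and> avoids_all (drop 2 \<sigma>) {[1,2,3], [1,3,2], [2,1,3]}"
    using foot_sortable_perm_ordering[of s \<tau> n] \<sigma>(1) av[of \<tau>] av[of "tl \<tau>"] sub
    unfolding \<sigma>(2) Let_def sock_perm_perm_ordering[OF \<sigma>(1)] by (auto simp: s)
next
  assume "n \<ge> 2"
  let ?P = "{\<sigma> \<in> permutations_of_set {1..n}. foot_sortable (perm_ordering n \<sigma>)}"
  have "{\<rho>. alignment_free_2_uniform n \<rho> \<and> foot_sortable \<rho>} = perm_ordering n ` ?P"
    using alignment_free_imp_perm_ordering perm_ordering_alignment_free by blast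
  moreover have "inj_on (perm_ordering n) ?P"
    using inj_on_perm_ordering by (rule inj_on_subset) auto
  ultimately show "card {\<rho>. alignment_free_2_uniform n \<rho> \<and> foot_sortable \<rho>} = (n - 1) * fib (n + 1)"
    using card_foot_sortable_perms[OF \<open>n \<ge> 2\<close>] by (simp add: card_image)
qed

end
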